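(* Let $\rho\in\mathbb{R}^{3}$ and let $R\in\mathbb{SO}(3)$ be the rotation matrix whose Rodriguez parameters vector is $\rho$, i.e. $R=\frac{1}{1+\Vert\rho\Vert^{2}}\left((1-\Vert\rho\Vert^{2})\mathbf{I}_{3}+2\rho\rho^{\top}+2[\rho]_{\times}\right)$. Let $M=M^{\top}\in\mathbb{R}^{3\times3}$ have rank $3$ and $\mathrm{Tr}\{M\}=3$. Define $\bar{\mathbf{M}}=\mathrm{Tr}\{M\}\mathbf{I}_{3}-M$ and let $\underline{\lambda}=\underline{\lambda}(\bar{\mathbf{M}})$ be the minimum singular value of $\bar{\mathbf{M}}$. Then $$\left\Vert MR\right\Vert_{I}=\frac{1}{2}\frac{\rho^{\top}\bar{\mathbf{M}}\rho}{1+\Vert\rho\Vert^{2}},$$ $$\mathbf{vex}\left(\boldsymbol{\mathcal{P}}_{a}(MR)\right)=\frac{\left(\mathbf{I}_{3}+[\rho]_{\times}\right)^{\top}\bar{\mathbf{M}}}{1+\Vert\rho\Vert^{2}}\rho,$$ $$\left\Vert \mathbf{vex}\left(\boldsymbol{\mathcal{P}}_{a}(MR)\right)\right\Vert^{2}=\frac{\rho^{\top}\bar{\mathbf{M}}\left(\mathbf{I}_{3}-[\rho]_{\times}^{2}\right)\bar{\mathbf{M}}\rho}{\left(1+\Vert\rho\Vert^{2}\right)^{2}},$$ and, provided $\underline{\lambda}>0$, $$\left\Vert MR\right\Vert_{I}\leq\frac{2}{\underline{\lambda}}\,\frac{\left\Vert \mathbf{vex}\left(\boldsymbol{\mathcal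{P}}_{a}(MR)\right)\right\Vert^{2}}{1+\mathrm{Tr}\{M^{-1}MR\}}.$$
   Context: $\mathbb{SO}(3)=\{R\in\mathbb{R}^{3\times3}: R^{\top}R=RR^{\top}=\mathbf{I}_{3},\ \det(R)=+1\}$; $\Vert\cdot\Vert$ is the Euclidean norm on vectors. For $x=[x_1,x_2,x_3]^{\top}\in\mathbb{R}^{3}$, $[x]_{\times}=\begin{bmatrix} 0 & -x_3 & x_2 \\ x_3 & 0 & -x_1 \\ -x_2 & x_1 & 0 \end{bmatrix}$, so $[x]_{\times} y=x\times y$. The map $\mathbf{vex}$ from $3\times3$ skew-symmetric matrices to $\mathbb{R}^{3}$ is the inverse of $[\cdot]_{\times}$, i.e. $\mathbf{vex}([x]_{\times})=x$. For $B\in\mathbb{R}^{3\times3}$, $\boldsymbol{\mathcal{P}}_{a}(B)=\frac{1}{2}(B-B^{\top})$. The notation $\Vert MR\Vert_{I}$ means $\Vert MR\Vert_{I}=\frac{1}{4}\mathrm{Tr}\{M(\mathbf{I}_{3}-R)\}$ (a real number, not a matrix norm of $MR$). *)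

theory Defs
  imports "HOL-Analysis.Analysis"
begin

definition skew :: "real^3 \<Rightarrow> real^3^3" where
  "skew x = vector [vector [    0, - x$3,   x$2],
                    vector [  x$3,     0, - x$1],
                    vector [- x$2,   x$1,     0]]"

lemma skew_mult_vec: "skew x *v y = cross3 x y"
  by (simp add: skew_def cross3_def vec_eq_iff forall_3 matrix_vector_mult_def sum_3)

lemma inj_skew: "inj skew"
  by (auto simp: inj_def skew_def vec_eq_iff forall_3)

text \<open>Only the values on skew-symmetric matrices, which form the range of \<^const>\<open>skew\<close>,
  are meaningful.\<close>
definition vex :: "real^3^3 \<Rightarrow> real^3" where
  "vex = the_inv skew"

lemma range_skew: "range skew = {A. transpose A = - A}"
proof (intro subset_antisym subsetI)
  fix A assume "A \<in> range skew"
  then obtain x where "A = skew x"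
    by blast
  then have "transpose A $ i $ j = (- A) $ i $ j" for i j
    using exhaust_3[of i] exhaust_3[of j] by (auto simp: skew_def transpose_def)
  then show "A \<in> {A. transpose A = - A}"
    by (simp add: vec_eq_iff)
next
  fix A :: "real^3^3" assume "A \<in> {A. transpose A = - A}"
  then have *: "transpose A = - A"
    by simp
  have "A $ j $ i = - (A $ i $ j)" for i j
    using arg_cong[OF *, of "\<lambda>B. B $ i $ j"] by (simp add: transpose_def)
  from this[of 1 1] this[of 2 2] this[of 3 3] this[of 1 2] this[of 3 1] this[of 2 3]
  have "A = skew (vector [A$3$2, A$1$3, A$2$1])"
    unfolding skew_def vec_eq_iff forall_3 vector_3 by (intro conjI; linarith)
  then show "A \<in> range skew"
    by blast
qed

lemma vex_skew: "vex (skew x) = x"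
  by (simp add: vex_def the_inv_f_f inj_skew)

definition anti_proj :: "real^3^3 \<Rightarrow> real^3^3" where
  "anti_proj B = (1/2) *\<^sub>R (B - transpose B)"

text \<open>The quantity $\|MR\|_I$. It is a function of the pair \<open>(M, R)\<close>, not of the product
  \<open>M ** R\<close> alone.\<close>
definition norm_I :: "real^3^3 \<Rightarrow> real^3^3 \<Rightarrow> real" where
  "norm_I M R = (1/4) * trace (M ** (mat 1 - R))"

definition rodrigues :: "real^3 \<Rightarrow> real^3^3" where
  "rodrigues \<rho> = (1 / (1 + (norm \<rho>)\<^sup>2)) *\<^sub>R
     ((1 - (norm \<rho>)\<^sup>2) *\<^sub>R mat 1
      + 2 *\<^sub>R (columnvector \<rho> ** (rowvector \<rho> :: real^3^1))
      + 2 *\<^sub>R skew \<rho>)"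

definition bar_matrix :: "real^3^3 \<Rightarrow> real^3^3" where
  "bar_matrix M = trace M *\<^sub>R mat 1 - M"

definition singular_values :: "real^'n^'m \<Rightarrow> real set" where
  "singular_values A =
     {sqrt \<mu> | \<mu>. \<exists>v. v \<noteq> 0 \<and> (transpose A ** A) *v v = \<mu> *\<^sub>R v}"

definition min_singular_value :: "real^'n^'m \<Rightarrow> real" where
  "min_singular_value A = Min (singular_values A)"

end

theory Submission
  imports Defs
begin

text \<open>
  Write \<open>w = Mbar *v \<rho>\<close> and \<open>n = (norm \<rho>)\<^sup>2\<close>. Since \<open>w\<close> is orthogonal to \<open>\<rho> \<times> w\<close>, the squared norm
  in the third identity is \<open>((norm w)\<^sup>2 + (norm (\<rho> \<times> w))\<^sup>2) / (1 + n)\<^sup>2\<close>. As \<open>1 + trace R = 4 / (1 + n)\<close>,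
  the inequality reduces to \<open>lam * (\<rho> \<bullet> w) \<le> (norm w)\<^sup>2 + (norm (\<rho> \<times> w))\<^sup>2\<close>, which follows from
  Cauchy--Schwarz and \<open>lam * norm \<rho> \<le> norm w\<close>, the latter because the minimum of
  \<open>norm (Mbar *v v)\<close> on the unit sphere is itself a singular value.
\<close>

section \<open>Singular values and the lower bound they give for
  \<open>norm (A *v v)\<close>\<close>

lemma inner_transpose_matrix:
  fixes A :: "real^'n^'m"
  shows "v \<bullet> (transpose A *v w) = (A *v v) \<bullet> w"
  by (metis dot_lmul_matrix inner_commute transpose_matrix_vector)

lemma norm_matrix_vector_sq:
  fixes A :: "real^'n^'m"
  shows "(norm (A *v v))\<^sup>2 = v \<bullet> ((transpose A ** A) *v v)"
  unfolding power2_norm_eq_inner matrix_vector_mul_assoc[symmetric] inner_transpose_matrix ..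

text \<open>Eigenvectors of the symmetric matrix \<open>transpose A ** A\<close> for distinct
  eigenvalues are orthogonal, hence independent, so the dimension bounds the number of eigenvalues.
  Finiteness is what gives the \<open>Min\<close> in \<open>min_singular_value\<close> its meaning
  as a lower bound.\<close>

lemma finite_singular_values:
  fixes A :: "real^'n^'m"
  shows "finite (singular_values A)"
proof -
  define S where "S = transpose A ** A"
  define E where "E = {\<mu>. \<exists>v. v \<noteq> 0 \<and> S *v v = \<mu> *\<^sub>R v}"
  have "transpose S = S"
    by (simp add: S_def matrix_transpose_mul)
  then have symm: "(S *v v) \<bullet> w = v \<bullet> (S *v w)" for v w
    by (metis inner_transpose_matrix)
  have "\<forall>\<mu>\<in>E. \<exists>v. v \<noteq> 0 \<and> S *v v = \<mu> *\<^sub>R v"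
    by (simp add: E_def)
  then obtain f where f: "\<forall>\<mu>\<in>E. f \<mu> \<noteq> 0 \<and> S *v f \<mu> = \<mu> *\<^sub>R f \<mu>"
    unfolding bchoice_iff by blast
  have orth: "f \<mu> \<bullet> f \<nu> = 0" if "\<mu> \<in> E" "\<nu> \<in> E" "\<mu> \<noteq> \<nu>" for \<mu> \<nu>
    using symm[of "f \<mu>" "f \<nu>"] f that by simp
  have "inj_on f E"
    using orth f by (metis inj_onI inner_eq_zero_iff)
  moreover have "independent (f ` E)"
    by (rule pairwise_orthogonal_independent)
      (use orth f in \<open>auto simp: pairwise_def orthogonal_def\<close>)
  ultimately have "finite E"
    using independent_bound finite_imageD by blast
  moreover have "singular_values A = sqrt ` E"
    by (auto simp: singular_values_def E_def S_def)
  ultimately show ?thesis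
    by simp
qed

text \<open>A minimiser of a nonnegative quadratic form along a line is a critical point, hence a zero
  of a positive semidefinite form lies in its kernel.\<close>
lemma psd_form_zero_imp_kernel:
  fixes B :: "real^'n^'n"
  assumes symm: "transpose B = B"
    and pos: "\<And>v. 0 \<le> v \<bullet> (B *v v)"
    and zero: "u \<bullet> (B *v u) = 0"
  shows "B *v u = 0"
proof (rule ccontr)
  assume "B *v u \<noteq> 0"
  define w where "w = B *v u"
  define a where "a = w \<bullet> w"
  define b where "b = w \<bullet> (B *v w)"
  have "a > 0"
    using \<open>B *v u \<noteq> 0\<close> by (simp add: a_def w_def)
  have "b \<ge> 0"
    by (simp add: b_def pos)
  \<comment> \<open>Along \<open>u - t *\<^sub>R w\<close> the form equals
    \<open>t\<^sup>2 * b - 2 * t * a\<close>, which is negative for small positive \<open>t\<close>.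
    The exact minimiser would be \<open>a / b\<close>; adding 1 keeps the denominator positive when
    \<open>b = 0\<close>.\<close>
  define t where "t = a / (b + 1)"
  have "t > 0"
    using \<open>a > 0\<close> \<open>b \<ge> 0\<close> by (simp add: t_def)
  have "u \<bullet> (B *v w) = a"
    using inner_transpose_matrix[of u B w] by (simp add: symm a_def w_def del: transpose_matrix_vector)
  moreover have "w \<bullet> (B *v u) = a"
    by (simp add: a_def w_def)
  ultimately have "(u - t *\<^sub>R w) \<bullet> (B *v (u - t *\<^sub>R w)) = t\<^sup>2 * b - 2 * t * a"
    using zero by (simp add: b_def power2_eq_square algebra_simps)
  then have "t * (2 * a) \<le> t * (t * b)"
    using pos[of "u - t *\<^sub>R w"] by (simp add: power2_eq_square algebra_simps)
  then have "2 * a \<le> t * b"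
    using \<open>t > 0\<close> by simp
  also have "\<dots> \<le> t * (b + 1)"
    using \<open>t > 0\<close> by simp
  also have "\<dots> = a"
    using \<open>b \<ge> 0\<close> by (simp add: t_def)
  finally show False
    using \<open>a > 0\<close> by simp
qed

text \<open>Let \<open>s\<close> be the minimum of \<open>norm (A *v v)\<close> on the unit sphere,
  attained at \<open>u\<close>. The matrix
  \<open>transpose A ** A - s\<^sup>2 *\<^sub>R mat 1\<close> is positive semidefinite and its form
  vanishes at \<open>u\<close>, so \<open>u\<close> lies in its kernel. Thus \<open>s\<close> is a
  singular value, and homogeneity extends the bound from the sphere to all vectors.\<close>

lemma min_singular_value_le:
  fixes A :: "real^'n^'m"
  shows "min_singular_value A * norm v \<le> norm (A *v v)"
proof -
  have "\<exists>u\<in>sphere 0 1. \<forall>v\<in>sphere 0 1. norm (A *v u) \<le> norm (A *v v)"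
  proof (rule continuous_attains_inf)
    show "sphere (0 :: real^'n) 1 \<noteq> {}"
      by simp
    show "continuous_on (sphere 0 1) (\<lambda>v. norm (A *v v))"
      by (intro continuous_intros linear_continuous_on_compose matrix_vector_mul_linear)
  qed simp
  then obtain u where u: "norm u = 1"
    and min: "\<And>v. norm v = 1 \<Longrightarrow> norm (A *v u) \<le> norm (A *v v)"
    by auto
  define s where "s = norm (A *v u)"
  have lower: "s * norm v \<le> norm (A *v v)" for v
  proof (cases "v = 0")
    case False
    then have "s \<le> norm (A *v ((1 / norm v) *\<^sub>R v))"
      unfolding s_def by (intro min) simp
    then show ?thesis
      using False by (simp add: matrix_vector_mult_scaleR field_simps)
  qed simp
  define B where "B = transpose A ** A - s\<^sup>2 *\<^sub>R mat 1"
  have B_mult: "B *v v = (transpose A ** A) *v v - s\<^sup>2 *\<^sub>R v" for v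
    by (simp add: B_def matrix_vector_mult_diff_rdistrib scaleR_matrix_vector_assoc[symmetric])
  have B_form: "v \<bullet> (B *v v) = (norm (A *v v))\<^sup>2 - (s * norm v)\<^sup>2" for v
    unfolding B_mult norm_matrix_vector_sq
    by (simp add: inner_diff_right power_mult_distrib power2_norm_eq_inner)
  have "B *v u = 0"
  proof (rule psd_form_zero_imp_kernel)
    show "transpose B = B"
      by (simp add: B_def vec_eq_iff transpose_def mat_def matrix_matrix_mult_def mult.commute)
    show "0 \<le> v \<bullet> (B *v v)" for v
      using lower[of v] by (simp add: B_form power_mono s_def)
    show "u \<bullet> (B *v u) = 0"
      by (simp add: B_form u s_def)
  qed
  then have "(transpose A ** A) *v u = s\<^sup>2 *\<^sub>R u"
    by (simp add: B_mult)
  moreover have "u \<noteq> 0"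
    using u by auto
  ultimately have "sqrt (s\<^sup>2) \<in> singular_values A"
    unfolding singular_values_def by blast
  then have "s \<in> singular_values A"
    by (simp add: s_def)
  then have "min_singular_value A \<le> s"
    unfolding min_singular_value_def by (intro Min_le finite_singular_values)
  then have "min_singular_value A * norm v \<le> s * norm v"
    by (rule mult_right_mono) simp
  also note lower
  finally show ?thesis .
qed

section \<open>Algebra of traces, skew matrices and the antisymmetric projection\<close>

lemma trace_3: "trace (A :: real^3^3) = A$1$1 + A$2$2 + A$3$3"
  by (simp add: trace_def sum_3)

lemma trace_scaleR: "trace (c *\<^sub>R A :: real^'n^'n) = c * trace A"
  by (simp add: trace_def sum_distrib_left)

lemma columnvector_mult_rowvector:
  "columnvector x ** (rowvector y :: real^'n^1) = (\<chi> i j. x$i * y$j)"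
  by (simp add: vec_eq_iff matrix_matrix_mult_def columnvector_def rowvector_def)

lemma transpose_skew: "transpose (skew x) = - skew x"
  using range_skew by blast

lemma skew_add: "skew (x + y) = skew x + skew y"
  by (simp add: skew_def vec_eq_iff forall_3)

lemma skew_scaleR: "skew (c *\<^sub>R x) = c *\<^sub>R skew x"
  by (simp add: skew_def vec_eq_iff forall_3)

lemma symmetric_matrix_nth:
  assumes "transpose M = M"
  shows "M$j$i = M$i$j"
  using arg_cong[OF assms, of "\<lambda>A. A$i$j"] by (simp add: transpose_def)

lemma anti_proj_add: "anti_proj (A + B) = anti_proj A + anti_proj B"
  by (simp add: anti_proj_def vec_eq_iff transpose_def field_simps)

lemma anti_proj_scaleR: "anti_proj (c *\<^sub>R A) = c *\<^sub>R anti_proj A"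
  by (simp add: anti_proj_def vec_eq_iff transpose_def right_diff_distrib)

text \<open>For symmetric \<open>M\<close> the left side is half of
  \<open>M ** skew x + skew x ** M\<close>, and this sum is the skew matrix of
  \<open>trace M *\<^sub>R x - M *v x\<close>. This is where \<open>bar_matrix\<close> enters the
  formula for \<open>vex\<close>.\<close>

lemma anti_proj_mult_skew:
  assumes "transpose M = M"
  shows "anti_proj (M ** skew x) = (1/2) *\<^sub>R skew (bar_matrix M *v x)"
  using symmetric_matrix_nth[OF assms, of 1 2] symmetric_matrix_nth[OF assms, of 1 3]
    symmetric_matrix_nth[OF assms, of 2 3]
  by (simp add: anti_proj_def bar_matrix_def skew_def trace_3 vec_eq_iff forall_3 sum_3
      matrix_matrix_mult_def matrix_vector_mult_def transpose_def mat_def field_simps)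

text \<open>A matrix form of the triple product rule: \<open>cross3 (cross3 y x) z\<close> equals
  \<open>(y \<bullet> z) *\<^sub>R x - (x \<bullet> z) *\<^sub>R y\<close>.\<close>

lemma anti_proj_outer: "anti_proj (\<chi> i j. x$i * y$j) = (1/2) *\<^sub>R skew (cross3 y x)"
  by (simp add: anti_proj_def skew_def cross3_def vec_eq_iff forall_3 transpose_def algebra_simps)

section \<open>Trace and antisymmetric part of \<open>M ** rodrigues \<rho>\<close>\<close>

lemma mult_rodrigues:
  "M ** rodrigues \<rho> = (1 / (1 + (norm \<rho>)\<^sup>2)) *\<^sub>R
     ((1 - (norm \<rho>)\<^sup>2) *\<^sub>R M + 2 *\<^sub>R (\<chi> i j. (M *v \<rho>)$i * \<rho>$j) + 2 *\<^sub>R (M ** skew \<rho>))"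
proof -
  have "M ** (\<chi> i j. \<rho>$i * \<rho>$j) = (\<chi> i j. (M *v \<rho>)$i * \<rho>$j)"
    by (simp add: vec_eq_iff matrix_matrix_mult_def matrix_vector_mult_def sum_distrib_right
        mult.assoc)
  then show ?thesis
    by (simp add: rodrigues_def columnvector_mult_rowvector matrix_add_ldistrib
        matrix_scalar_ac scalar_matrix_assoc[symmetric] scaleR_add_right)
qed

text \<open>The skew term has zero trace against a symmetric \<open>M\<close>, and the outer product
  contributes the quadratic form of \<open>M\<close>. The case \<open>M = mat 1\<close> yields the
  trace of the rotation itself.\<close>

lemma trace_mult_rodrigues:
  assumes "transpose M = M"
  shows "trace (M ** rodrigues \<rho>) =
    ((1 - (norm \<rho>)\<^sup>2) * trace M + 2 * (\<rho> \<bullet> (M *v \<rho>))) / (1 + (norm \<rho>)\<^sup>2)"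
proof -
  have "trace (M ** skew \<rho>) = 0"
    using symmetric_matrix_nth[OF assms, of 1 2] symmetric_matrix_nth[OF assms, of 1 3]
      symmetric_matrix_nth[OF assms, of 2 3]
    by (simp add: trace_3 skew_def matrix_matrix_mult_def sum_3)
  moreover have "trace (\<chi> i j. (M *v \<rho>)$i * \<rho>$j) = \<rho> \<bullet> (M *v \<rho>)"
    by (simp add: trace_def inner_vec_def mult.commute)
  ultimately show ?thesis
    by (simp add: mult_rodrigues trace_add trace_scaleR)
qed

lemma bar_matrix_mult_vec: "bar_matrix M *v x = trace M *\<^sub>R x - M *v x"
  by (simp add: bar_matrix_def matrix_vector_mult_diff_rdistrib scaleR_matrix_vector_assoc[symmetric])

lemma norm_I_rodrigues:
  assumes "transpose M = M"
  shows "norm_I M (rodrigues \<rho>) = (1/2) * ((\<rho> \<bullet> (bar_matrix M *v \<rho>)) / (1 + (norm \<rho>)\<^sup>2))"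
proof -
  have "M ** (mat 1 - rodrigues \<rho>) + M ** rodrigues \<rho> = M"
    by (simp flip: matrix_add_ldistrib)
  then have "M ** (mat 1 - rodrigues \<rho>) = M - M ** rodrigues \<rho>"
    by (simp add: eq_diff_eq)
  then have "norm_I M (rodrigues \<rho>) = (1/4) * (trace M - trace (M ** rodrigues \<rho>))"
    by (simp add: norm_I_def trace_sub)
  moreover have "1 + (norm \<rho>)\<^sup>2 \<noteq> 0"
    by (simp add: add_nonneg_eq_0_iff)
  ultimately show ?thesis
    by (simp add: trace_mult_rodrigues[OF assms] bar_matrix_mult_vec inner_diff_right
        power2_norm_eq_inner[symmetric] divide_simps) (simp add: algebra_simps)
qed

text \<open>Of the three terms of \<open>M ** rodrigues \<rho>\<close>, the multiple of
  \<open>M\<close> is symmetric and drops out, the outer product gives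
  \<open>cross3 \<rho> (M *v \<rho>)\<close>, and the skew term gives
  \<open>bar_matrix M *v \<rho>\<close>.\<close>

lemma vex_anti_proj_rodrigues:
  assumes "transpose M = M"
  shows "vex (anti_proj (M ** rodrigues \<rho>)) = (1 / (1 + (norm \<rho>)\<^sup>2)) *\<^sub>R
    (bar_matrix M *v \<rho> - cross3 \<rho> (bar_matrix M *v \<rho>))"
proof -
  have "anti_proj M = 0"
    by (simp add: anti_proj_def assms)
  \<comment> \<open>The part \<open>trace M *\<^sub>R \<rho>\<close> of
    \<open>bar_matrix M *v \<rho>\<close> is parallel to \<open>\<rho>\<close> and vanishes in the
    cross product.\<close>
  moreover have "cross3 \<rho> (bar_matrix M *v \<rho>) = - cross3 \<rho> (M *v \<rho>)"
    by (simp add: bar_matrix_mult_vec right_diff_distrib cross_mult_right Cross3.right_diff_distrib)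
  ultimately have "anti_proj (M ** rodrigues \<rho>) = skew ((1 / (1 + (norm \<rho>)\<^sup>2)) *\<^sub>R
      (bar_matrix M *v \<rho> - cross3 \<rho> (bar_matrix M *v \<rho>)))"
    by (simp add: mult_rodrigues anti_proj_add anti_proj_scaleR anti_proj_outer
        anti_proj_mult_skew[OF assms] skew_add skew_scaleR add.commute)
  then show ?thesis
    by (simp add: vex_skew)
qed

theorem lemma8:
  fixes \<rho> :: "real^3" and R M Mbar :: "real^3^3" and lam :: real
  assumes "rotation_matrix R"
    and "R = rodrigues \<rho>"
    and "transpose M = M"
    and "rank M = 3"
    and "trace M = 3"
    and "Mbar = bar_matrix M"
    and "lam = min_singular_value Mbar"
  shows "norm_I M R = (1/2) * ((\<rho> \<bullet> (Mbar *v \<rho>)) / (1 + (norm \<rho>)\<^sup>2))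
    \<and> vex (anti_proj (M ** R))
        = ((1 / (1 + (norm \<rho>)\<^sup>2)) *\<^sub>R (transpose (mat 1 + skew \<rho>) ** Mbar)) *v \<rho>
    \<and> (norm (vex (anti_proj (M ** R))))\<^sup>2
        = (\<rho> \<bullet> ((Mbar ** (mat 1 - skew \<rho> ** skew \<rho>) ** Mbar) *v \<rho>))
          / (1 + (norm \<rho>)\<^sup>2)\<^sup>2
    \<and> (lam > 0 \<longrightarrow>
        norm_I M R
          \<le> (2 / lam) * ((norm (vex (anti_proj (M ** R))))\<^sup>2
              / (1 + trace (matrix_inv M ** M ** R))))"
proof -
  define n where "n = (norm \<rho>)\<^sup>2"
  have n: "1 + n > 0"
    by (simp add: n_def add_pos_nonneg)
  define w where "w = Mbar *v \<rho>"
  note R = \<open>R = rodrigues \<rho>\<close> and Mbar = \<open>Mbar = bar_matrix M\<close> and symm = \<open>transpose M = M\<close>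
  have normI: "norm_I M R = (1/2) * ((\<rho> \<bullet> w) / (1 + n))"
    by (simp add: R Mbar n_def w_def norm_I_rodrigues[OF symm])
  have vexP: "vex (anti_proj (M ** R)) = (1 / (1 + n)) *\<^sub>R (w - cross3 \<rho> w)"
    by (simp add: R Mbar n_def w_def vex_anti_proj_rodrigues[OF symm])
  have "transpose (mat 1 + skew \<rho>) = mat 1 + transpose (skew \<rho>)"
    by (simp add: vec_eq_iff transpose_def mat_def)
  then have "transpose (mat 1 + skew \<rho>) = mat 1 - skew \<rho>"
    by (simp add: transpose_skew)
  then have vexP': "vex (anti_proj (M ** R))
      = ((1 / (1 + n)) *\<^sub>R (transpose (mat 1 + skew \<rho>) ** Mbar)) *v \<rho>"
    by (simp add: vexP w_def scaleR_matrix_vector_assoc[symmetric] matrix_vector_mul_assoc[symmetric]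
        matrix_vector_mult_diff_rdistrib skew_mult_vec)
  have "(w - cross3 \<rho> w) \<bullet> (w - cross3 \<rho> w) = (norm w)\<^sup>2 + (norm (cross3 \<rho> w))\<^sup>2"
    by (simp add: inner_diff_left inner_diff_right dot_cross_self power2_norm_eq_inner)
  then have sq: "(norm (vex (anti_proj (M ** R))))\<^sup>2
      = ((norm w)\<^sup>2 + (norm (cross3 \<rho> w))\<^sup>2) / (1 + n)\<^sup>2"
    using n by (simp add: vexP power_mult_distrib power_divide flip: power2_norm_eq_inner)
  have "transpose Mbar = Mbar"
    unfolding Mbar bar_matrix_def using symmetric_matrix_nth[OF symm]
    by (simp add: vec_eq_iff transpose_def mat_def)
  then have "\<rho> \<bullet> (Mbar *v x) = w \<bullet> x" for x
    unfolding w_def by (metis inner_transpose_matrix)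
  \<comment> \<open>The map \<open>cross3 \<rho>\<close> is skew-adjoint, so moving one factor
    across the inner product costs a sign.\<close>
  moreover have "w \<bullet> cross3 \<rho> (cross3 \<rho> w) = - (norm (cross3 \<rho> w))\<^sup>2"
    by (simp add: cross3_def inner_vec_def sum_3 power2_norm_eq_inner algebra_simps)
  ultimately have form: "\<rho> \<bullet> ((Mbar ** (mat 1 - skew \<rho> ** skew \<rho>) ** Mbar) *v \<rho>)
      = (norm w)\<^sup>2 + (norm (cross3 \<rho> w))\<^sup>2"
    by (simp add: w_def[symmetric] matrix_vector_mul_assoc[symmetric] skew_mult_vec
        matrix_vector_mult_diff_rdistrib inner_diff_right power2_norm_eq_inner)
  have bound: "norm_I M R \<le> (2 / lam) * ((norm (vex (anti_proj (M ** R))))\<^sup>2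
              / (1 + trace (matrix_inv M ** M ** R)))" if "lam > 0"
  proof -
    \<comment> \<open>Full rank makes \<open>matrix_inv M\<close> a genuine inverse, so the trace in
      the denominator is that of \<open>R\<close> alone.\<close>
    have "invertible M"
      using \<open>rank M = 3\<close> by (simp add: invertible_left_inverse matrix_left_invertible_injective
          full_rank_injective[symmetric])
    then have "matrix_inv M ** M = mat 1"
      unfolding invertible_def matrix_inv_def by (rule someI2_ex) simp
    then have "matrix_inv M ** M ** R = mat 1 ** rodrigues \<rho>"
      by (simp add: R)
    then have "trace (matrix_inv M ** M ** R) = (3 - n) / (1 + n)"
      by (simp only: trace_mult_rodrigues[OF transpose_mat])
        (simp add: trace_I power2_norm_eq_inner n_def)
    then have tr: "1 + trace (matrix_inv M ** M ** R) = 4 / (1 + n)"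
      using n by (simp add: field_simps)
    have "lam * (\<rho> \<bullet> w) \<le> (lam * norm \<rho>) * norm w"
      using norm_cauchy_schwarz[of \<rho> w] \<open>lam > 0\<close> by simp
    also have "\<dots> \<le> norm w * norm w"
      using min_singular_value_le[of Mbar \<rho>]
      by (intro mult_right_mono) (simp_all add: \<open>lam = min_singular_value Mbar\<close> w_def)
    also have "\<dots> \<le> (norm w)\<^sup>2 + (norm (cross3 \<rho> w))\<^sup>2"
      by (simp add: power2_eq_square)
    finally have key: "lam * (\<rho> \<bullet> w) \<le> (norm w)\<^sup>2 + (norm (cross3 \<rho> w))\<^sup>2" .
    have "norm_I M R = lam * (\<rho> \<bullet> w) / (2 * lam * (1 + n))"
      using that by (simp add: normI)
    also have "\<dots> \<le> ((norm w)\<^sup>2 + (norm (cross3 \<rho> w))\<^sup>2) / (2 * lam * (1 + n))"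
      using key n that by (intro divide_right_mono) simp_all
    \<comment> \<open>Dividing by \<open>4 / (1 + n)\<close> cancels one of the two factors
      \<open>1 + n\<close> in the squared norm, and \<open>2 / lam\<close> over 4 leaves
      \<open>1 / (2 * lam)\<close>.\<close>
    also have "\<dots> = (2 / lam) * ((norm (vex (anti_proj (M ** R))))\<^sup>2
              / (1 + trace (matrix_inv M ** M ** R)))"
      unfolding sq tr using n that by (simp add: divide_simps power2_eq_square) (simp add: algebra_simps)
    finally show ?thesis .
  qed
  show ?thesis
    using normI vexP' sq form bound unfolding n_def w_def by auto
qed

end
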